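(* Let $X$ be an abstract state space and let $P$ be a Markov projection on $X$. Then the set $\Xi_P^{u}(X)$ is $\rho_1$-dense and $\rho_1$-open in $\Xi_P^{inv}(X)$.
   Context: Abstract state space: $X$ is an ordered (real) vector space with a generating positive cone $X_+$ (i.e. $X=X_+-X_+$), and $f$ is a strictly positive linear functional on $X$ such that $\mathcal{K}=\{x\in X_+: f(x)=1\}$ is a base of $X_+$. With $U:=\mathrm{conv}(\mathcal{K}\cup(-\mathcal{K}))$ put $\|x\|=\inf\{\lambda\in\mathbb{R}_+: x\in\lambda U\}$. It is assumed that $\|\cdot\|$ is a norm, that $X$ is complete for it, and that $X_+$ is closed; then $(X,X_+,\mathcal{K},f)$ (or simply $X$) is an abstract state space. A linear operator $T:X\to X$ is positive if $Tx\ge 0$ whenever $x\ge 0$; a positive linear operator with $T(\mathcal{K})\subset\mathcal{K}$ is called Markov. A Markov projection is a Markov operator $P$ with $P^2=P$. A $C_0$-Markov semigroup is a family $\mathcal{T}=(T_t)_{t\ge0}$ of Markov operators on $X$ with $T_0=I$, $T_{t+s}=T_tT_s$ for all $t,s\ge0$, and $\|T_tx-x\|\to0$ as $t\downarrow0$ for every $x\in X$. Let $\Xi(X)$ be the set of all $C_0$-Markov semigroups on $X$, and $\Xi_P(X)$ the set of $\mathcal{T}\in\Xi(X)$ with $T_tP=PT_t$ for all $t\ge0$. The semigroup $\mathcal{T}$ is uniformly $P$-ergodic if $\lim_{t\to\infty}\|T_t-P\|=0$ (operator norm). Put $$\Xi_P^{u}(X)=\{\mathcal{T}\in\Xi_P(X):\mathcal{T}\text{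 is uniformly }P\text{-ergodic}\},\qquad \Xi_P^{inv}(X)=\{\mathcal{T}\in\Xi_P(X): T_tP=P\ \ \forall t\ge0\};$$ one has $\Xi_P^{u}(X)\subset\Xi_P^{inv}(X)$. The metric $\rho_1$ is $\rho_1(\mathcal{T},\mathcal{S})=\sup_{t\in[0,1]}\|T_t-S_t\|$ for $\mathcal{T},\mathcal{S}\in\Xi(X)$. *)

theory Defs
  imports "HOL-Analysis.Analysis"
begin

section \<open>Abstract state spaces\<close>

definition pos_cone :: "'a::ordered_real_vector set"
  where "pos_cone = {x. 0 \<le> x}"

definition state_base :: "('a::ordered_real_vector \<Rightarrow> real) \<Rightarrow> 'a set"
  where "state_base f = {x \<in> pos_cone. f x = 1}"

definition is_base_of_cone :: "'a::real_vector set \<Rightarrow> 'a set \<Rightarrow> bool"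
  where "is_base_of_cone K C \<longleftrightarrow>
    convex K \<and> K \<subseteq> C \<and>
    (\<forall>x\<in>C - {0}. \<exists>!p. 0 < fst p \<and> snd p \<in> K \<and> x = fst p *\<^sub>R snd p)"

definition base_norm :: "('a::ordered_real_vector \<Rightarrow> real) \<Rightarrow> 'a \<Rightarrow> real"
  where "base_norm f x =
    Inf {l. 0 \<le> l \<and> x \<in> (\<lambda>u. l *\<^sub>R u) ` (convex hull (state_base f \<union> uminus ` state_base f))}"

text \<open>
  The norm of the type is required to coincide with \<^const>\<open>base_norm\<close>. The requirements that
  \<^const>\<open>base_norm\<close> is a norm and that the space is complete for it are then the axioms of the
  class \<^class>\<open>banach\<close>, and \<^const>\<open>closed\<close> and \<^const>\<open>onorm\<close> refer to this norm.
\<close>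

locale abstract_state_space =
  fixes f :: "'a::{ordered_real_vector, banach} \<Rightarrow> real"
  assumes generating: "\<exists>y\<in>pos_cone. \<exists>z\<in>pos_cone. x = y - z"
    and linear_f: "linear f"
    and strictly_positive: "x \<in> pos_cone \<Longrightarrow> x \<noteq> 0 \<Longrightarrow> 0 < f x"
    and base: "is_base_of_cone (state_base f) (pos_cone :: 'a set)"
    and norm_eq_base_norm: "norm x = base_norm f x"
    and closed_pos_cone: "closed (pos_cone :: 'a set)"


section \<open>Markov operators and Markov semigroups\<close>

definition positive_operator :: "('a::ordered_real_vector \<Rightarrow> 'a) \<Rightarrow> bool"
  where "positive_operator T \<longleftrightarrow> linear T \<and> (\<forall>x\<ge>0. 0 \<le> T x)"

definition markov :: "('a::ordered_real_vector \<Rightarrow> real) \<Rightarrow> ('a \<Rightarrow> 'a) \<Rightarrow> bool"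
  where "markov f T \<longleftrightarrow> positive_operator T \<and> T ` state_base f \<subseteq> state_base f"

definition markov_projection :: "('a::ordered_real_vector \<Rightarrow> real) \<Rightarrow> ('a \<Rightarrow> 'a) \<Rightarrow> bool"
  where "markov_projection f P \<longleftrightarrow> markov f P \<and> P \<circ> P = P"

text \<open>
  A family indexed by \<open>t \<ge> 0\<close> is a function on \<^typ>\<open>real\<close> that is \<^const>\<open>undefined\<close> at negative
  arguments, so that equality of functions is equality of families.
\<close>

definition markov_semigroups ::
    "('a::{ordered_real_vector, real_normed_vector} \<Rightarrow> real) \<Rightarrow> (real \<Rightarrow> 'a \<Rightarrow> 'a) set"
  where "markov_semigroups f = {T \<in> extensional {0..}.
    (\<forall>t\<ge>0. markov f (T t)) \<and>
    T 0 = id \<and>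
    (\<forall>t\<ge>0. \<forall>s\<ge>0. T (t + s) = T t \<circ> T s) \<and>
    (\<forall>x. ((\<lambda>t. norm (T t x - x)) \<longlongrightarrow> 0) (at_right 0))}"

definition markov_semigroups_comm ::
    "('a::{ordered_real_vector, real_normed_vector} \<Rightarrow> real) \<Rightarrow> ('a \<Rightarrow> 'a) \<Rightarrow> (real \<Rightarrow> 'a \<Rightarrow> 'a) set"
  where "markov_semigroups_comm f P = {T \<in> markov_semigroups f. \<forall>t\<ge>0. T t \<circ> P = P \<circ> T t}"

definition uniformly_ergodic ::
    "('a::real_normed_vector \<Rightarrow> 'a) \<Rightarrow> (real \<Rightarrow> 'a \<Rightarrow> 'a) \<Rightarrow> bool"
  where "uniformly_ergodic P T \<longleftrightarrow> ((\<lambda>t. onorm (\<lambda>x. T t x - P x)) \<longlongrightarrow> 0) at_top"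

definition markov_semigroups_u ::
    "('a::{ordered_real_vector, real_normed_vector} \<Rightarrow> real) \<Rightarrow> ('a \<Rightarrow> 'a) \<Rightarrow> (real \<Rightarrow> 'a \<Rightarrow> 'a) set"
  where "markov_semigroups_u f P = {T \<in> markov_semigroups_comm f P. uniformly_ergodic P T}"

definition markov_semigroups_inv ::
    "('a::{ordered_real_vector, real_normed_vector} \<Rightarrow> real) \<Rightarrow> ('a \<Rightarrow> 'a) \<Rightarrow> (real \<Rightarrow> 'a \<Rightarrow> 'a) set"
  where "markov_semigroups_inv f P = {T \<in> markov_semigroups_comm f P. \<forall>t\<ge>0. T t \<circ> P = P}"


section \<open>The metric on the set of Markov semigroups\<close>

text \<open>
  The value \<open>0\<close> outside the set of semigroups is there because \<^locale>\<open>Metric_space\<close> asks for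
  nonnegativity at all arguments; it has no influence on the topology below.
\<close>

definition rho1 ::
    "('a::{ordered_real_vector, real_normed_vector} \<Rightarrow> real) \<Rightarrow> (real \<Rightarrow> 'a \<Rightarrow> 'a) \<Rightarrow> (real \<Rightarrow> 'a \<Rightarrow> 'a) \<Rightarrow> real"
  where "rho1 f T S =
    (if T \<in> markov_semigroups f \<and> S \<in> markov_semigroups f
     then SUP t\<in>{0..1}. onorm (\<lambda>x. T t x - S t x) else 0)"

definition rho1_topology ::
    "('a::{ordered_real_vector, real_normed_vector} \<Rightarrow> real) \<Rightarrow> (real \<Rightarrow> 'a \<Rightarrow> 'a) topology"
  where "rho1_topology f = Metric_space.mtopology (markov_semigroups f) (rho1 f)"

context abstract_state_space
begin

lemma base_norm_set_nonempty:
  assumes "x \<noteq> 0"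
  shows "{l. 0 \<le> l \<and> x \<in> (\<lambda>u. l *\<^sub>R u) ` (convex hull (state_base f \<union> uminus ` state_base f))} \<noteq> {}"
proof -
  let ?K = "state_base f"
  interpret f: linear f by (rule linear_f)
  have normalize: "(1 / f y) *\<^sub>R y \<in> ?K" "0 < f y" if "y \<in> pos_cone" "y \<noteq> 0" for y
    using that strictly_positive[OF that] f.scaleR
    by (auto simp: state_base_def pos_cone_def intro!: scaleR_nonneg_nonneg)
  obtain y z where yz: "y \<in> pos_cone" "z \<in> pos_cone" "x = y - z"
    using generating by blast
  obtain k0 where k0: "k0 \<in> ?K"
    using yz \<open>x \<noteq> 0\<close> normalize by (metis diff_self)
  have rep: "\<exists>k\<in>?K. y = f y *\<^sub>R k" "0 \<le> f y" if "y \<in> pos_cone" for y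
  proof -
    show "\<exists>k\<in>?K. y = f y *\<^sub>R k"
    proof (cases "y = 0")
      case True
      then show ?thesis using k0 f.zero by auto
    next
      case False
      then show ?thesis
        using normalize[OF that False] by (intro bexI[of _ "(1 / f y) *\<^sub>R y"]) auto
    qed
    show "0 \<le> f y" using strictly_positive[OF that] f.zero by (cases "y = 0") auto
  qed
  obtain k where k: "k \<in> ?K" "y = f y *\<^sub>R k" using rep yz by blast
  obtain k' where k': "k' \<in> ?K" "z = f z *\<^sub>R k'" using rep yz by blast
  define l where "l = f y + f z"
  have nn: "0 \<le> f y" "0 \<le> f z" using rep yz by auto
  have "l > 0"
  proof (rule ccontr)
    assume "\<not> l > 0"
    then have "f y = 0" "f z = 0" using nn by (auto simp: l_def)
    then show False using k k' yz \<open>x \<noteq> 0\<close> by simp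
  qed
  let ?u = "(f y / l) *\<^sub>R k + (f z / l) *\<^sub>R (- k')"
  have "?u \<in> convex hull (?K \<union> uminus ` ?K)"
    by (rule convexD[OF convex_convex_hull])
      (use k k' nn \<open>l > 0\<close> in \<open>auto intro!: hull_inc simp: add_divide_distrib[symmetric] l_def[symmetric]\<close>)
  moreover have "x = l *\<^sub>R ?u"
    using \<open>l > 0\<close> yz(3) k(2) k'(2) by (simp add: scaleR_diff_right)
  ultimately show ?thesis using \<open>l > 0\<close> by (auto intro!: exI[of _ l])
qed

lemma markov_norm_le:
  assumes "markov f T"
  shows "norm (T x) \<le> norm x"
proof (cases "x = 0")
  case True
  have "linear T" using assms by (simp add: markov_def positive_operator_def)
  then show ?thesis using True by (simp add: linear_0)
next
  case False
  let ?V = "state_base f \<union> uminus ` state_base f"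
  interpret T: linear T using assms by (simp add: markov_def positive_operator_def)
  have "T ` ?V \<subseteq> ?V"
    using assms by (auto simp: markov_def T.neg)
  then have "T ` (convex hull ?V) \<subseteq> convex hull ?V"
    by (metis T.linear_axioms convex_hull_linear_image hull_mono)
  then have "T x \<in> (\<lambda>u. l *\<^sub>R u) ` (convex hull ?V)"
    if "x \<in> (\<lambda>u. l *\<^sub>R u) ` (convex hull ?V)" for l
    using that T.scaleR by auto
  then show ?thesis
    unfolding norm_eq_base_norm base_norm_def
    by (intro cInf_superset_mono base_norm_set_nonempty False bdd_belowI[of _ 0]) auto
qed

lemma markov_bounded_linear: "markov f T \<Longrightarrow> bounded_linear T"
  using markov_norm_le
  by (intro bounded_linear.intro bounded_linear_axioms.intro exI[of _ 1])
     (auto simp: markov_def positive_operator_def)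

lemma onorm_markov_le: "markov f T \<Longrightarrow> onorm T \<le> 1"
  using markov_norm_le by (intro onorm_bound) auto

lemma onorm_markov_diff_le:
  assumes "markov f T" "markov f S"
  shows "onorm (\<lambda>x. T x - S x) \<le> 2"
proof (rule onorm_bound)
  fix x
  show "norm (T x - S x) \<le> 2 * norm x"
    using norm_triangle_ineq4[of "T x" "S x"] markov_norm_le[OF assms(1), of x]
      markov_norm_le[OF assms(2), of x] by linarith
qed simp

lemma markov_semigroups_markov: "T \<in> markov_semigroups f \<Longrightarrow> 0 \<le> t \<Longrightarrow> markov f (T t)"
  by (simp add: markov_semigroups_def)

lemma bdd_above_rho1:
  assumes "T \<in> markov_semigroups f" "S \<in> markov_semigroups f"
  shows "bdd_above ((\<lambda>t. onorm (\<lambda>x. T t x - S t x)) ` {0..1})"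
  using assms by (auto intro!: bdd_aboveI2[of _ _ 2] onorm_markov_diff_le markov_semigroups_markov)

lemma onorm_le_rho1:
  assumes "T \<in> markov_semigroups f" "S \<in> markov_semigroups f" "t \<in> {0..1}"
  shows "onorm (\<lambda>x. T t x - S t x) \<le> rho1 f T S"
  unfolding rho1_def using assms cSUP_upper[OF assms(3) bdd_above_rho1[OF assms(1,2)]] by simp

lemma bounded_linear_semigroup_diff:
  assumes "T \<in> markov_semigroups f" "S \<in> markov_semigroups f" "0 \<le> t"
  shows "bounded_linear (\<lambda>x. T t x - S t x)"
  using assms by (intro bounded_linear_sub markov_bounded_linear markov_semigroups_markov)

lemma markov_semigroups_power:
  assumes "T \<in> markov_semigroups f" "0 \<le> s"
  shows "T (real n * s) = T s ^^ n"
proof (induction n)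
  case 0
  then show ?case using assms by (simp add: markov_semigroups_def)
next
  case (Suc n)
  have "T (real (Suc n) * s) = T (s + real n * s)" by (simp add: algebra_simps)
  also have "\<dots> = T s \<circ> T (real n * s)"
    using assms by (simp add: markov_semigroups_def)
  finally show ?case using Suc by simp
qed

lemma Metric_space_rho1: "Metric_space (markov_semigroups f) (rho1 f)"
proof
  show "0 \<le> rho1 f T S" for T S
  proof (cases "T \<in> markov_semigroups f \<and> S \<in> markov_semigroups f")
    case True
    then have "0 \<le> onorm (\<lambda>x. T 0 x - S 0 x)"
      by (intro onorm_pos_le bounded_linear_semigroup_diff) auto
    also have "\<dots> \<le> rho1 f T S" using True by (intro onorm_le_rho1) auto
    finally show ?thesis .
  qed (auto simp: rho1_def)
next
  have "onorm (\<lambda>x. T t x - S t x) = onorm (\<lambda>x. S t x - T t x)" for T S :: "real \<Rightarrow> 'a \<Rightarrow> 'a" and t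
    unfolding onorm_def by (simp add: norm_minus_commute)
  then show "rho1 f T S = rho1 f S T" for T S
    by (auto simp: rho1_def)
next
  fix T S assume TS: "T \<in> markov_semigroups f" "S \<in> markov_semigroups f"
  show "rho1 f T S = 0 \<longleftrightarrow> T = S"
  proof
    assume "T = S"
    then show "rho1 f T S = 0" using TS by (simp add: rho1_def onorm_zero)
  next
    assume 0: "rho1 f T S = 0"
    have eq: "T t = S t" if "t \<in> {0..1}" for t
    proof -
      have "onorm (\<lambda>x. T t x - S t x) = 0"
        using onorm_le_rho1[OF TS that] 0 that
          onorm_pos_le[OF bounded_linear_semigroup_diff[OF TS]] by (simp add: order_antisym)
      then show ?thesis
        using onorm_eq_0[OF bounded_linear_semigroup_diff[OF TS]] that by auto
    qed
    have "T t = S t" if "0 \<le> t" for t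
    proof -
      obtain n where n: "t \<le> real n" using real_arch_simple by blast
      define m where "m = Suc n"
      have m: "t / m \<in> {0..1}" "real m * (t / m) = t"
        using n that by (auto simp: m_def divide_simps)
      then show ?thesis
        using markov_semigroups_power[OF TS(1), of "t / m" m]
          markov_semigroups_power[OF TS(2), of "t / m" m] eq[OF m(1)] by simp
    qed
    moreover have "T t = S t" if "\<not> 0 \<le> t" for t
      using TS that by (simp add: markov_semigroups_def extensional_def)
    ultimately show "T = S" by blast
  qed
next
  fix T S R assume TSR: "T \<in> markov_semigroups f" "S \<in> markov_semigroups f" "R \<in> markov_semigroups f"
  have "onorm (\<lambda>x. T t x - R t x) \<le> rho1 f T S + rho1 f S R" if "t \<in> {0..1}" for t
  proof -
    have "onorm (\<lambda>x. T t x - R t x) = onorm (\<lambda>x. (T t x - S t x) + (S t x - R t x))" by simp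
    also have "\<dots> \<le> onorm (\<lambda>x. T t x - S t x) + onorm (\<lambda>x. S t x - R t x)"
      using that TSR by (intro onorm_triangle bounded_linear_semigroup_diff) auto
    also have "\<dots> \<le> rho1 f T S + rho1 f S R"
      using that TSR by (intro add_mono onorm_le_rho1) auto
    finally show ?thesis .
  qed
  then show "rho1 f T R \<le> rho1 f T S + rho1 f S R"
    using TSR unfolding rho1_def[of f T R] by (auto intro!: cSUP_least)
qed

end

end

theory Submission
  imports Defs
begin

text \<open>
  A semigroup \<open>T\<close> in \<open>markov_semigroups_inv f P\<close> satisfies \<open>T t \<circ> P = P = P \<circ> T t\<close>. With
  \<open>P \<circ> P = P\<close> this gives \<open>(T t - P) \<circ> (T s - P) = T (t + s) - P\<close>, so the deviations
  \<open>T t - P\<close> multiply like a semigroup; everything rests on this identity.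

  \<^bold>\<open>Density.\<close> Because \<open>P\<close> absorbs every \<open>T t\<close>, mixing \<open>P\<close> into \<open>T\<close> with a weight that tends
  to \<open>1\<close>, \<open>S t = exp (- e * t) T t + (1 - exp (- e * t)) P\<close>, again gives a Markov semigroup
  that commutes with \<open>P\<close> and fixes its range. Its deviation is \<open>S t - P = exp (- e * t) (T t - P)\<close>,
  of norm at most \<open>2 exp (- e * t)\<close>, so it is uniformly ergodic for every \<open>e > 0\<close>;
  its \<open>rho1\<close>-distance to \<open>T\<close> is at most \<open>2 (1 - exp (- e))\<close>, which is small when \<open>e\<close> is
  (lemmas \<open>damped_in_markov_semigroups_u\<close> and \<open>rho1_damped_le\<close>).

  \<^bold>\<open>Openness.\<close> By the same identity, a single strict contraction \<open>\<parallel>T s - P\<parallel> < 1\<close> already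
  forces \<open>T t\<close> to converge to \<open>P\<close> (lemma \<open>uniformly_ergodic_if_contraction\<close>). Hence uniform
  ergodicity is visible at one integer time \<open>n\<close>. Since \<open>T n\<close> is the \<open>n\<close>-th power of \<open>T 1\<close> and
  Markov operators do not increase norms, \<open>T n\<close> moves by at most \<open>n\<close> times the
  \<open>rho1\<close>-distance when \<open>T\<close> is perturbed (lemma \<open>onorm_diff_at_nat_le\<close>), so a strict
  contraction at time \<open>n\<close> persists in a \<open>rho1\<close>-ball.
\<close>

lemma markov_semigroups_inv_subset: "markov_semigroups_inv f P \<subseteq> markov_semigroups f"
  by (auto simp: markov_semigroups_inv_def markov_semigroups_comm_def)

lemma markov_semigroups_inv_absorb:
  assumes "T \<in> markov_semigroups_inv f P" "0 \<le> t"
  shows "T t (P x) = P x" and "P (T t x) = P x"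
proof -
  have eq: "T t \<circ> P = P" "P \<circ> T t = P"
    using assms unfolding markov_semigroups_inv_def markov_semigroups_comm_def by auto
  show "T t (P x) = P x" "P (T t x) = P x"
    using fun_cong[OF eq(1), of x] fun_cong[OF eq(2), of x] by simp_all
qed

lemma markov_semigroups_add:
  "T \<in> markov_semigroups f \<Longrightarrow> 0 \<le> t \<Longrightarrow> 0 \<le> s \<Longrightarrow> T (t + s) x = T t (T s x)"
  by (simp add: markov_semigroups_def)

lemma markov_projectionD:
  assumes "markov_projection f P"
  shows "markov f P" and "P (P x) = P x"
proof -
  show "markov f P" using assms by (simp add: markov_projection_def)
  have "P \<circ> P = P" using assms by (simp add: markov_projection_def)
  from fun_cong[OF this, of x] show "P (P x) = P x" by simp
qed

lemma markov_convex_combination: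
  assumes "linear f" "markov f T" "markov f S" "0 \<le> c" "c \<le> 1"
  shows "markov f (\<lambda>x. c *\<^sub>R T x + (1 - c) *\<^sub>R S x)"
proof -
  interpret f: linear f by fact
  have "linear T" "linear S" using assms by (auto simp: markov_def positive_operator_def)
  then have "linear (\<lambda>x. c *\<^sub>R T x + (1 - c) *\<^sub>R S x)"
    by (intro linear_compose_add linear_compose_scale_right)
  moreover have "0 \<le> c *\<^sub>R T x + (1 - c) *\<^sub>R S x" if "0 \<le> x" for x
    using that assms
    by (auto simp: markov_def positive_operator_def intro!: add_nonneg_nonneg scaleR_nonneg_nonneg)
  moreover have "f (c *\<^sub>R T x + (1 - c) *\<^sub>R S x) = 1" if "x \<in> state_base f" for x
  proof -
    have "f (T x) = 1" "f (S x) = 1"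
      using that assms by (auto simp: markov_def state_base_def)
    then show ?thesis by (simp add: f.add f.scaleR)
  qed
  ultimately show ?thesis
    by (auto simp: markov_def positive_operator_def state_base_def pos_cone_def)
qed

context abstract_state_space
begin

section \<open>Uniform ergodicity from one strict contraction\<close>

lemma markov_semigroups_u_subset_inv:
  assumes P: "markov f P"
  shows "markov_semigroups_u f P \<subseteq> markov_semigroups_inv f P"
proof
  fix T assume "T \<in> markov_semigroups_u f P"
  then have comm: "T \<in> markov_semigroups_comm f P" and erg: "uniformly_ergodic P T"
    by (auto simp: markov_semigroups_u_def)
  then have T: "T \<in> markov_semigroups f" by (auto simp: markov_semigroups_comm_def)
  have lim: "((\<lambda>s. T s x) \<longlongrightarrow> P x) at_top" for x
  proof (rule LIM_zero_cancel, rule Lim_null_comparison)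
    show "\<forall>\<^sub>F s in at_top. norm (T s x - P x) \<le> onorm (\<lambda>x. T s x - P x) * norm x"
      using eventually_ge_at_top[of 0]
    proof eventually_elim
      case (elim s)
      show ?case
        by (rule onorm[of "\<lambda>x. T s x - P x"])
          (intro bounded_linear_sub markov_bounded_linear P markov_semigroups_markov[OF T elim])
    qed
    show "((\<lambda>s. onorm (\<lambda>x. T s x - P x) * norm x) \<longlongrightarrow> 0) at_top"
      using erg unfolding uniformly_ergodic_def by (rule tendsto_mult_left_zero)
  qed
  have "T t \<circ> P = P" if t: "0 \<le> t" for t
  proof
    fix x
    \<comment> \<open>Both \<open>T s (T t x)\<close> and \<open>T (t + s) x\<close> converge as \<open>s\<close> grows, so \<open>P (T t x) = P x\<close>.\<close>
    have "((\<lambda>s. T (t + s) x) \<longlongrightarrow> P x) at_top"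
      by (rule filterlim_compose[OF lim])
        (rule filterlim_tendsto_add_at_top[OF tendsto_const filterlim_ident])
    moreover have "\<forall>\<^sub>F s in at_top. T (t + s) x = T s (T t x)"
      using eventually_ge_at_top[of 0]
      by eventually_elim (simp add: add.commute[of t] markov_semigroups_add[OF T _ t])
    ultimately have "((\<lambda>s. T s (T t x)) \<longlongrightarrow> P x) at_top"
      by (rule Lim_transform_eventually)
    then have "P (T t x) = P x"
      using lim by (metis tendsto_unique trivial_limit_at_top_linorder)
    then show "(T t \<circ> P) x = P x"
      using comm t by (auto simp: markov_semigroups_comm_def fun_eq_iff)
  qed
  then show "T \<in> markov_semigroups_inv f P"
    using comm by (simp add: markov_semigroups_inv_def)
qed

text \<open>
  The constant \<open>2\<close> accounts for \<open>n = 0\<close>, where \<open>T 0 - P = id - P\<close> need not be a contraction.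
\<close>

lemma norm_diff_multiple_le:
  assumes T: "T \<in> markov_semigroups_inv f P" and P: "markov_projection f P" and "0 \<le> s"
  shows "norm (T (real n * s) x - P x) \<le> 2 * onorm (\<lambda>x. T s x - P x) ^ n * norm x"
proof (induction n)
  case 0
  note mP = markov_projectionD(1)[OF P]
  note TS = subsetD[OF markov_semigroups_inv_subset T]
  have "T 0 x = x" using TS by (simp add: markov_semigroups_def)
  then show ?case
    using norm_triangle_ineq4[of x "P x"] markov_norm_le[OF mP, of x] by simp
next
  case (Suc n)
  note mP = markov_projectionD(1)[OF P]
  note TS = subsetD[OF markov_semigroups_inv_subset T]
  let ?D = "\<lambda>x. T s x - P x" and ?y = "T (real n * s) x - P x"
  have mT: "markov f (T s)" using TS \<open>0 \<le> s\<close> by (rule markov_semigroups_markov)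
  then have lin: "linear (T s)" "linear P"
    using mP by (auto simp: markov_def positive_operator_def)
  have bl: "bounded_linear ?D"
    by (intro bounded_linear_sub markov_bounded_linear mT mP)
  have "T (s + real n * s) x = T s (T (real n * s) x)"
    using \<open>0 \<le> s\<close> by (intro markov_semigroups_add[OF TS]) auto
  moreover have "T s (P x) = P x" "P (P x) = P (T (real n * s) x)"
    using markov_semigroups_inv_absorb[OF T] markov_projectionD(2)[OF P] \<open>0 \<le> s\<close> by auto
  ultimately have "T (real (Suc n) * s) x - P x = ?D ?y"
    using lin by (simp add: linear_diff algebra_simps)
  then have "norm (T (real (Suc n) * s) x - P x) \<le> onorm ?D * norm ?y"
    using onorm[OF bl, of ?y] by simp
  also have "\<dots> \<le> onorm ?D * (2 * onorm ?D ^ n * norm x)"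
    using Suc.IH onorm_pos_le[OF bl] by (rule mult_left_mono)
  finally show ?case by (simp add: algebra_simps)
qed

text \<open>
  The previous bound gives geometric decay along the multiples of \<open>s\<close>. Between them nothing is
  lost: \<open>T t - P = (T r - P) \<circ> T (t - r)\<close> for \<open>0 \<le> r \<le> t\<close>, and \<open>T (t - r)\<close> does not increase norms.
\<close>

lemma uniformly_ergodic_if_contraction:
  assumes T: "T \<in> markov_semigroups_inv f P" and P: "markov_projection f P"
    and s: "0 \<le> s" and q: "onorm (\<lambda>x. T s x - P x) < 1"
  shows "uniformly_ergodic P T"
  unfolding uniformly_ergodic_def
proof (rule tendstoI)
  note mP = markov_projectionD(1)[OF P]
  note TS = subsetD[OF markov_semigroups_inv_subset T]
  fix e :: real assume "0 < e"
  let ?q = "onorm (\<lambda>x. T s x - P x)"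
  have bl: "bounded_linear (\<lambda>x. T t x - P x)" if "0 \<le> t" for t
    by (intro bounded_linear_sub markov_bounded_linear mP markov_semigroups_markov[OF TS that])
  have q0: "0 \<le> ?q" by (rule onorm_pos_le[OF bl[OF s]])
  obtain n where n: "?q ^ n < e / 2"
    using real_arch_pow_inv[OF _ q, of "e / 2"] \<open>0 < e\<close> by auto
  have "norm (onorm (\<lambda>x. T t x - P x)) < e" if t: "real n * s \<le> t" for t
  proof -
    have ns: "0 \<le> real n * s" using s by simp
    have "onorm (\<lambda>x. T t x - P x) \<le> 2 * ?q ^ n"
    proof (rule onorm_bound)
      fix x
      let ?y = "T (t - real n * s) x"
      have split: "T t x = T (real n * s) ?y"
        using markov_semigroups_add[OF TS ns, of "t - real n * s" x] t by simp
      have "P ?y = P x"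
        using t by (intro markov_semigroups_inv_absorb(2)[OF T]) simp
      with norm_diff_multiple_le[OF T P s, of n ?y]
      have "norm (T t x - P x) \<le> 2 * ?q ^ n * norm ?y"
        by (simp only: split)
      also have "\<dots> \<le> 2 * ?q ^ n * norm x"
        using q0 t by (intro mult_left_mono markov_norm_le markov_semigroups_markov[OF TS]) auto
      finally show "norm (T t x - P x) \<le> 2 * ?q ^ n * norm x" .
    qed (use q0 in simp)
    moreover have "0 \<le> onorm (\<lambda>x. T t x - P x)"
      using ns t by (intro onorm_pos_le bl) simp
    ultimately show ?thesis using n by simp
  qed
  then show "\<forall>\<^sub>F t in at_top. dist (onorm (\<lambda>x. T t x - P x)) 0 < e"
    by (auto simp: eventually_at_top_linorder)
qed

section \<open>Stability of a strict contraction at an integer time\<close>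

text \<open>
  Telescoping \<open>A ^ Suc n - B ^ Suc n = A (A ^ n - B ^ n) + (A - B) B ^ n\<close> costs one copy of
  \<open>\<parallel>A - B\<parallel>\<close> per factor, because \<open>A\<close> and \<open>B\<close> do not increase norms.
\<close>

lemma norm_markov_power_diff_le:
  assumes A: "markov f A" and B: "markov f B"
  shows "norm ((A ^^ n) x - (B ^^ n) x) \<le> real n * onorm (\<lambda>x. A x - B x) * norm x"
proof (induction n)
  case (Suc n)
  let ?d = "onorm (\<lambda>x. A x - B x)" and ?a = "(A ^^ n) x" and ?b = "(B ^^ n) x"
  have bl: "bounded_linear (\<lambda>x. A x - B x)"
    by (intro bounded_linear_sub markov_bounded_linear A B)
  have b: "norm ?b \<le> norm x"
  proof (induction n)
    case (Suc n)
    then show ?case using markov_norm_le[OF B, of "(B ^^ n) x"] by simp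
  qed simp
  have "A ?a - B ?b = A (?a - ?b) + (A ?b - B ?b)"
    using A by (simp add: markov_def positive_operator_def linear_diff)
  then have "norm (A ?a - B ?b) \<le> norm (A (?a - ?b)) + norm (A ?b - B ?b)"
    by (simp only: norm_triangle_ineq)
  also have "\<dots> \<le> real n * ?d * norm x + ?d * norm x"
  proof (rule add_mono)
    show "norm (A (?a - ?b)) \<le> real n * ?d * norm x"
      using markov_norm_le[OF A] Suc.IH by (rule order_trans)
    show "norm (A ?b - B ?b) \<le> ?d * norm x"
      using onorm[OF bl] mult_left_mono[OF b onorm_pos_le[OF bl]] by (rule order_trans)
  qed
  finally show ?case by (simp add: distrib_right)
qed simp

lemma onorm_diff_at_nat_le:
  assumes T: "T \<in> markov_semigroups f" and S: "S \<in> markov_semigroups f"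
  shows "onorm (\<lambda>x. T (real n) x - S (real n) x) \<le> real n * rho1 f T S"
proof -
  have m: "markov f (T 1)" "markov f (S 1)"
    using T S by (auto intro: markov_semigroups_markov)
  have "onorm (\<lambda>x. T (real n) x - S (real n) x) \<le> real n * onorm (\<lambda>x. T 1 x - S 1 x)"
    using norm_markov_power_diff_le[OF m] markov_semigroups_power[OF T, of 1 n]
      markov_semigroups_power[OF S, of 1 n]
      onorm_pos_le[OF bounded_linear_semigroup_diff[OF T S, of 1]]
    by (intro onorm_bound) auto
  also have "\<dots> \<le> real n * rho1 f T S"
    using onorm_le_rho1[OF T S, of 1] by (intro mult_left_mono) auto
  finally show ?thesis .
qed

text \<open>
  If \<open>T n\<close> is within \<open>1 / 2\<close> of \<open>P\<close>, a perturbation that moves \<open>T 1\<close> by less than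
  \<open>1 / (2 * n)\<close> keeps it within \<open>1\<close>.
\<close>

lemma markov_semigroups_u_ball:
  assumes T: "T \<in> markov_semigroups_u f P" and P: "markov_projection f P"
  obtains r where "0 < r"
    "\<And>S. S \<in> markov_semigroups_inv f P \<Longrightarrow> rho1 f T S < r \<Longrightarrow> S \<in> markov_semigroups_u f P"
proof -
  note mP = markov_projectionD(1)[OF P]
  have TS: "T \<in> markov_semigroups f"
    using T by (auto simp: markov_semigroups_u_def markov_semigroups_comm_def)
  have "((\<lambda>n. onorm (\<lambda>x. T (real n) x - P x)) \<longlongrightarrow> 0) sequentially"
    using T filterlim_compose[OF _ filterlim_real_sequentially]
    by (auto simp: markov_semigroups_u_def uniformly_ergodic_def)
  then have "\<forall>\<^sub>F n in sequentially. onorm (\<lambda>x. T (real n) x - P x) < 1 / 2"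
    by (rule order_tendstoD) simp
  then obtain N where "\<forall>n\<ge>N. onorm (\<lambda>x. T (real n) x - P x) < 1 / 2"
    by (auto simp: eventually_sequentially)
  then obtain n where n: "0 < n" "onorm (\<lambda>x. T (real n) x - P x) < 1 / 2"
    by (metis le_SucI order_refl zero_less_Suc)
  show ?thesis
  proof
    show "0 < 1 / (2 * real n)" using n by simp
    fix S assume S: "S \<in> markov_semigroups_inv f P" and r: "rho1 f T S < 1 / (2 * real n)"
    note SS = subsetD[OF markov_semigroups_inv_subset S]
    have "onorm (\<lambda>x. S (real n) x - P x)
        = onorm (\<lambda>x. (S (real n) x - T (real n) x) + (T (real n) x - P x))" by simp
    also have "\<dots> \<le> onorm (\<lambda>x. S (real n) x - T (real n) x) + onorm (\<lambda>x. T (real n) x - P x)"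
      by (intro onorm_triangle bounded_linear_sub markov_bounded_linear mP
          markov_semigroups_markov[OF TS] markov_semigroups_markov[OF SS]) auto
    also have "onorm (\<lambda>x. S (real n) x - T (real n) x) \<le> real n * rho1 f S T"
      by (rule onorm_diff_at_nat_le[OF SS TS])
    also have "real n * rho1 f S T < 1 / 2"
      using r n Metric_space.commute[OF Metric_space_rho1, of T S] by (simp add: field_simps)
    finally have "onorm (\<lambda>x. S (real n) x - P x) < 1" using n by simp
    then have "uniformly_ergodic P S"
      by (intro uniformly_ergodic_if_contraction[OF S P, of "real n"]) auto
    then show "S \<in> markov_semigroups_u f P"
      using S by (simp add: markov_semigroups_u_def markov_semigroups_inv_def)
  qed
qed

end

section \<open>Damping towards the projection\<close>

text \<open>
  In terms of generators, damping adds the bounded operator \<open>e (P - id)\<close>.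
\<close>

definition damped :: "real \<Rightarrow> ('a \<Rightarrow> 'a) \<Rightarrow> (real \<Rightarrow> 'a \<Rightarrow> 'a) \<Rightarrow> real \<Rightarrow> 'a \<Rightarrow> 'a::real_vector"
  where "damped e P T =
    (\<lambda>t\<in>{0..}. \<lambda>x. exp (- e * t) *\<^sub>R T t x + (1 - exp (- e * t)) *\<^sub>R P x)"

context abstract_state_space
begin

lemma damped_in_markov_semigroups_inv:
  assumes T: "T \<in> markov_semigroups_inv f P" and P: "markov_projection f P" and e: "0 \<le> e"
  shows "damped e P T \<in> markov_semigroups_inv f P"
proof -
  note mP = markov_projectionD(1)[OF P]
  note TS = subsetD[OF markov_semigroups_inv_subset T]
  note absorb = markov_semigroups_inv_absorb[OF T]
  have linP: "linear P" using mP by (simp add: markov_def positive_operator_def)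
  have linT: "linear (T t)" if "0 \<le> t" for t
    using markov_semigroups_markov[OF TS that] by (simp add: markov_def positive_operator_def)
  have "markov f (damped e P T t)" if "0 \<le> t" for t
    using markov_convex_combination[OF linear_f markov_semigroups_markov[OF TS that] mP, of "exp (- e * t)"]
      that e by (simp add: damped_def)
  moreover have "damped e P T 0 = id"
    using TS by (auto simp: damped_def markov_semigroups_def)
  moreover have "damped e P T (t + s) = damped e P T t \<circ> damped e P T s"
    if "0 \<le> t" "0 \<le> s" for t s
  proof
    fix x
    define a b where "a = exp (- e * t)" and "b = exp (- e * s)"
    have "exp (- e * (t + s)) = a * b"
      by (simp add: a_def b_def distrib_left exp_add[symmetric])
    then have "damped e P T (t + s) x = (a * b) *\<^sub>R T t (T s x) + (1 - a * b) *\<^sub>R P x"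
      using that by (simp add: damped_def markov_semigroups_add[OF TS])
    moreover have s: "damped e P T s x = b *\<^sub>R T s x + (1 - b) *\<^sub>R P x"
      using that by (simp add: damped_def b_def)
    have "T t (damped e P T s x) = b *\<^sub>R T t (T s x) + (1 - b) *\<^sub>R P x"
      using that by (simp add: s linear_add[OF linT] linear_scale[OF linT] absorb)
    moreover have "P (damped e P T s x) = P x"
      using that absorb markov_projectionD(2)[OF P]
      by (simp add: s linear_add[OF linP] linear_scale[OF linP] scaleR_add_left[symmetric])
    moreover have "damped e P T t y = a *\<^sub>R T t y + (1 - a) *\<^sub>R P y" for y
      using that by (simp add: damped_def a_def)
    ultimately show "damped e P T (t + s) x = (damped e P T t \<circ> damped e P T s) x"
      by (simp add: scaleR_add_right scaleR_diff_left scaleR_diff_right)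
  qed
  moreover have "((\<lambda>t. norm (damped e P T t x - x)) \<longlongrightarrow> 0) (at_right 0)" for x
  proof -
    have "((\<lambda>t. T t x - x) \<longlongrightarrow> 0) (at_right 0)"
      using TS by (simp add: markov_semigroups_def tendsto_norm_zero_iff)
    moreover have ex: "((\<lambda>t. exp (- e * t)) \<longlongrightarrow> 1) (at_right 0)"
      by (rule tendsto_eq_intros refl | simp)+
    ultimately have "((\<lambda>t. exp (- e * t) *\<^sub>R (T t x - x) + (1 - exp (- e * t)) *\<^sub>R (P x - x))
        \<longlongrightarrow> 1 *\<^sub>R 0 + (1 - 1) *\<^sub>R (P x - x)) (at_right 0)"
      by (intro tendsto_intros)
    then have "((\<lambda>t. norm (exp (- e * t) *\<^sub>R (T t x - x) + (1 - exp (- e * t)) *\<^sub>R (P x - x)))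
        \<longlongrightarrow> 0) (at_right 0)"
      by (simp add: tendsto_norm_zero)
    moreover have "\<forall>\<^sub>F t in at_right 0. norm (exp (- e * t) *\<^sub>R (T t x - x)
        + (1 - exp (- e * t)) *\<^sub>R (P x - x)) = norm (damped e P T t x - x)"
      using eventually_at_right_less[of 0]
      by eventually_elim (simp add: damped_def algebra_simps)
    ultimately show ?thesis by (rule Lim_transform_eventually)
  qed
  moreover have "damped e P T t \<circ> P = P" "P \<circ> damped e P T t = P" if "0 \<le> t" for t
    using that absorb markov_projectionD(2)[OF P] linP
    by (auto simp: damped_def linear_add linear_scale scaleR_add_left[symmetric])
  moreover have "damped e P T \<in> extensional {0..}"
    by (simp add: damped_def)
  ultimately show ?thesis
    by (simp add: markov_semigroups_inv_def markov_semigroups_comm_def markov_semigroups_def)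
qed

lemma damped_in_markov_semigroups_u:
  assumes T: "T \<in> markov_semigroups_inv f P" and P: "markov_projection f P" and e: "0 < e"
  shows "damped e P T \<in> markov_semigroups_u f P"
proof -
  note mP = markov_projectionD(1)[OF P]
  note TS = subsetD[OF markov_semigroups_inv_subset T]
  have D: "damped e P T \<in> markov_semigroups_inv f P"
    by (rule damped_in_markov_semigroups_inv[OF T P less_imp_le[OF e]])
  \<comment> \<open>A time at which the bound \<open>2 exp (- e * s)\<close> on the distance to \<open>P\<close> is below \<open>1\<close>.\<close>
  define s where "s = ln 3 / e"
  have s: "0 \<le> s" "exp (- (e * s)) = 1 / 3"
    using e by (auto simp: s_def exp_minus field_simps)
  have "damped e P T s x - P x = exp (- (e * s)) *\<^sub>R (T s x - P x)" for x
    using s(1) by (simp add: damped_def algebra_simps)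
  then have "onorm (\<lambda>x. damped e P T s x - P x) = onorm (\<lambda>x. (1 / 3) *\<^sub>R (T s x - P x))"
    by (simp only: s(2))
  also have "\<dots> = 1 / 3 * onorm (\<lambda>x. T s x - P x)"
    by (subst onorm_scaleR)
      (simp_all add: bounded_linear_sub markov_bounded_linear mP markov_semigroups_markov[OF TS] s(1))
  also have "\<dots> < 1"
    using onorm_markov_diff_le[OF markov_semigroups_markov[OF TS s(1)] mP] by simp
  finally have "uniformly_ergodic P (damped e P T)"
    by (rule uniformly_ergodic_if_contraction[OF D P s(1)])
  then show ?thesis
    using D by (simp add: markov_semigroups_u_def markov_semigroups_inv_def)
qed

lemma rho1_damped_le:
  assumes T: "T \<in> markov_semigroups_inv f P" and P: "markov_projection f P" and e: "0 \<le> e"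
  shows "rho1 f T (damped e P T) \<le> 2 * (1 - exp (- e))"
proof -
  note mP = markov_projectionD(1)[OF P]
  note TS = subsetD[OF markov_semigroups_inv_subset T]
  note DS = subsetD[OF markov_semigroups_inv_subset damped_in_markov_semigroups_inv[OF T P e]]
  have "onorm (\<lambda>x. T t x - damped e P T t x) \<le> 2 * (1 - exp (- e))" if t: "t \<in> {0..1}" for t
  proof -
    have "onorm (\<lambda>x. T t x - damped e P T t x)
        = onorm (\<lambda>x. (1 - exp (- e * t)) *\<^sub>R (T t x - P x))"
      using t by (simp add: damped_def algebra_simps)
    also have "\<dots> = \<bar>1 - exp (- e * t)\<bar> * onorm (\<lambda>x. T t x - P x)"
      using t by (intro onorm_scaleR bounded_linear_sub markov_bounded_linear mP
          markov_semigroups_markov[OF TS]) auto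
    also have "\<dots> \<le> (1 - exp (- e)) * 2"
      using t e mult_left_le[of t e]
      by (intro mult_mono onorm_markov_diff_le mP markov_semigroups_markov[OF TS] onorm_pos_le
          bounded_linear_sub markov_bounded_linear) auto
    finally show ?thesis by simp
  qed
  then show ?thesis
    using TS DS by (auto simp: rho1_def intro!: cSUP_least)
qed

end

section \<open>Density and openness\<close>

theorem theorem3p10:
  fixes f :: "'a::{ordered_real_vector, banach} \<Rightarrow> real"
    and P :: "'a \<Rightarrow> 'a"
  assumes "abstract_state_space f"
    and "markov_projection f P"
  shows "subtopology (rho1_topology f) (markov_semigroups_inv f P)
           closure_of (markov_semigroups_u f P) = markov_semigroups_inv f P \<and>
         openin (subtopology (rho1_topology f) (markov_semigroups_inv f P))
           (markov_semigroups_u f P)"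
proof -
  interpret abstract_state_space f by fact
  note P = assms(2)
  let ?U = "markov_semigroups_u f P" and ?I = "markov_semigroups_inv f P"
  note UI = markov_semigroups_u_subset_inv[OF markov_projectionD(1)[OF P]]
  interpret M: Metric_space "markov_semigroups f" "rho1 f" by (rule Metric_space_rho1)
  interpret I: Submetric "markov_semigroups f" "rho1 f" ?I
    by unfold_locales (rule markov_semigroups_inv_subset)
  have top: "subtopology (rho1_topology f) ?I = I.sub.mtopology"
    by (simp add: rho1_topology_def I.mtopology_submetric)
  have "\<exists>S\<in>?U. S \<in> I.sub.mball T r" if T: "T \<in> ?I" and r: "0 < r" for T r
  proof -
    \<comment> \<open>Since \<open>1 - exp (- e) \<le> e\<close>, the value \<open>e = r / 4\<close> gives \<open>rho1\<close>-distance at most \<open>r / 2\<close>.\<close>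
    have "rho1 f T (damped (r / 4) P T) \<le> 2 * (1 - exp (- (r / 4)))"
      using r by (intro rho1_damped_le[OF T P]) simp
    also have "\<dots> < r"
      using exp_ge_add_one_self[of "- (r / 4)"] r by (simp add: field_simps)
    finally have "rho1 f T (damped (r / 4) P T) < r" .
    moreover have "damped (r / 4) P T \<in> ?U"
      using r by (intro damped_in_markov_semigroups_u[OF T P]) simp
    ultimately show ?thesis using T UI by (auto simp: I.sub.in_mball)
  qed
  then have "I.sub.mtopology closure_of ?U = ?I"
    by (auto simp: I.sub.metric_closure_of)
  moreover have "openin I.sub.mtopology ?U"
    unfolding I.sub.openin_mtopology
  proof (intro conjI UI allI impI)
    fix T assume "T \<in> ?U"
    from markov_semigroups_u_ball[OF this P] obtain r where "0 < r"
      "\<And>S. S \<in> ?I \<Longrightarrow> rho1 f T S < r \<Longrightarrow> S \<in> ?U" by blast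
    then show "\<exists>r>0. I.sub.mball T r \<subseteq> ?U"
      by (auto simp: I.sub.in_mball)
  qed
  ultimately show ?thesis by (simp add: top)
qed

end
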